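(* Let $\tau$ be a regular profinite tree set with no splitting two-star, let $\mathcal O'$ be the set of all consistent orientations of $\tau$ that have a greatest element, and let $\varphi\colon\tau\to\mathcal B(\mathcal O')$ be the map $\varphi(\vec s):=(\mathcal O'(\overleftarrow s),\mathcal O'(\vec s))$, where $\mathcal O'(\vec s):=\{O\in\mathcal O'\mid \vec s\in O\}$. Then $\varphi$ is an isomorphism of tree sets between $\tau$ and its image in $\mathcal B(\mathcal O')$.
   Context: A separation system $(\vec S,\le,{}^* )$ is a poset with an order-reversing involution $\vec s\mapsto\overleftarrow s$; $s=\{\vec s,\overleftarrow s\}$ is the unoriented separation. $\vec s$ is degenerate if $\vec s=\overleftarrow s$, small if $\vec s\le\overleftarrow s$; a separation system is regular if it has no small element. Unoriented $r,s$ are nested if some orientation of $r$ is $\le$ some orientation of $s$. $\vec r$ is trivial if there is $s$ with $\vec r<\vec s$ and $\vec r<\overleftarrow s$ (strictly). A tree set is a separation system in which any two separations are nested and which has no degenerate and no trivial elements. An orientation is a set $O$ containing exactly one orientation of every unoriented separation; it is consistent if there are no $\vec r,\vec s\in O$ with $r\ne s$ and $\overleftarrow r\le\vec s$. A star is a set $\sigma$ with $\vec r\le\overleftarrow s$ for all distinct $\vec r,\vec s\in\sigma$. $\sigma$ is a splitting star of $\tau$ if $\tau$ has a consistent orientation $O$ such that every element of $O$ lies below some element of $\sigma$ and $\sigma$ is the set of maximal elements of $O$; a splitting two-star is a splitting star with exactly two elements. For a set $X$, $\mathcal B(X)$ is the separation system of all ordered pairs $(A,B)$ with $A,B$ non-empty,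 $A\cap B=\emptyset$, $A\cup B=X$, ordered by $(A,B)\le(C,D)$ iff $A\subseteq C$ (equivalently $D\subseteq B$), with involution $(A,B)^*=(B,A)$. Homomorphisms commute with the involutions and preserve $\le$; an isomorphism is a bijective homomorphism whose inverse is a homomorphism. An inverse system of finite separation systems is a family $(\vec S_p)_{p\in P}$ over a directed poset $P$ with homomorphisms $f_{qp}\colon\vec S_q\to\vec S_p$ ($p\le q$), $f_{pp}=\mathrm{id}$, $f_{qp}f_{tq}=f_{tp}$; its inverse limit is the set of compatible families $(\vec s_p)$ with coordinatewise order and involution. A tree set is profinite if it is isomorphic to such an inverse limit. *)

theory Defs
  imports Main "HOL-Library.FuncSet"
begin

record 'a sepsys =
  seps :: "'a set"
  sle :: "'a \<Rightarrow> 'a \<Rightarrow> bool"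
  sinv :: "'a \<Rightarrow> 'a"

definition sless :: "'a sepsys \<Rightarrow> 'a \<Rightarrow> 'a \<Rightarrow> bool" where
  "sless S r s \<longleftrightarrow> sle S r s \<and> r \<noteq> s"

definition poset_on :: "'a set \<Rightarrow> ('a \<Rightarrow> 'a \<Rightarrow> bool) \<Rightarrow> bool" where
  "poset_on A R \<longleftrightarrow> reflp_on A R \<and> antisymp_on A R \<and> transp_on A R"

definition separation_system :: "'a sepsys \<Rightarrow> bool" where
  "separation_system S \<longleftrightarrow>
     poset_on (seps S) (sle S) \<and>
     sinv S ` seps S \<subseteq> seps S \<and>
     (\<forall>s\<in>seps S. sinv S (sinv S s) = s) \<and>
     (\<forall>r\<in>seps S. \<forall>s\<in>seps S. sle S r s \<longrightarrow> sle S (sinv S s) (sinv S r))"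

definition unoriented :: "'a sepsys \<Rightarrow> 'a \<Rightarrow> 'a set" where
  "unoriented S s = {s, sinv S s}"

definition degenerate :: "'a sepsys \<Rightarrow> 'a \<Rightarrow> bool" where
  "degenerate S s \<longleftrightarrow> s = sinv S s"

definition small :: "'a sepsys \<Rightarrow> 'a \<Rightarrow> bool" where
  "small S s \<longleftrightarrow> sle S s (sinv S s)"

definition trivial_sep :: "'a sepsys \<Rightarrow> 'a \<Rightarrow> bool" where
  "trivial_sep S r \<longleftrightarrow> (\<exists>s\<in>seps S. sless S r s \<and> sless S r (sinv S s))"

definition regular :: "'a sepsys \<Rightarrow> bool" where
  "regular S \<longleftrightarrow> (\<forall>s\<in>seps S. \<not> small S s)"

definition nested :: "'a sepsys \<Rightarrow> 'a \<Rightarrow> 'a \<Rightarrow> bool" where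
  "nested S r s \<longleftrightarrow> (\<exists>r'\<in>unoriented S r. \<exists>s'\<in>unoriented S s. sle S r' s')"

definition tree_set :: "'a sepsys \<Rightarrow> bool" where
  "tree_set S \<longleftrightarrow> separation_system S \<and>
     (\<forall>r\<in>seps S. \<forall>s\<in>seps S. nested S r s) \<and>
     (\<forall>s\<in>seps S. \<not> degenerate S s \<and> \<not> trivial_sep S s)"

definition orientation :: "'a sepsys \<Rightarrow> 'a set \<Rightarrow> bool" where
  "orientation S O' \<longleftrightarrow> O' \<subseteq> seps S \<and>
     (\<forall>s\<in>seps S. \<exists>!x. x \<in> O' \<and> x \<in> unoriented S s)"

definition consistent :: "'a sepsys \<Rightarrow> 'a set \<Rightarrow> bool" where
  "consistent S O' \<longleftrightarrow>
     \<not> (\<exists>r\<in>O'. \<exists>s\<in>O'. unoriented S r \<noteq> unoriented S s \<and> sle S (sinv S r) s)"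

definition star :: "'a sepsys \<Rightarrow> 'a set \<Rightarrow> bool" where
  "star S \<sigma> \<longleftrightarrow> \<sigma> \<subseteq> seps S \<and>
     (\<forall>r\<in>\<sigma>. \<forall>s\<in>\<sigma>. r \<noteq> s \<longrightarrow> sle S r (sinv S s))"

definition maximal_elements :: "'a sepsys \<Rightarrow> 'a set \<Rightarrow> 'a set" where
  "maximal_elements S A = {m \<in> A. \<not> (\<exists>x\<in>A. sless S m x)}"

definition splitting_star :: "'a sepsys \<Rightarrow> 'a set \<Rightarrow> bool" where
  "splitting_star S \<sigma> \<longleftrightarrow> star S \<sigma> \<and>
     (\<exists>O'. orientation S O' \<and> consistent S O' \<and>
        (\<forall>r\<in>O'. \<exists>s\<in>\<sigma>. sle S r s) \<and> \<sigma> = maximal_elements S O')"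

definition splitting_two_star :: "'a sepsys \<Rightarrow> 'a set \<Rightarrow> bool" where
  "splitting_two_star S \<sigma> \<longleftrightarrow> splitting_star S \<sigma> \<and> card \<sigma> = 2"

definition hom_sep :: "'a sepsys \<Rightarrow> 'b sepsys \<Rightarrow> ('a \<Rightarrow> 'b) \<Rightarrow> bool" where
  "hom_sep S T f \<longleftrightarrow> f ` seps S \<subseteq> seps T \<and>
     (\<forall>s\<in>seps S. f (sinv S s) = sinv T (f s)) \<and>
     (\<forall>r\<in>seps S. \<forall>s\<in>seps S. sle S r s \<longrightarrow> sle T (f r) (f s))"

definition iso_sep :: "'a sepsys \<Rightarrow> 'b sepsys \<Rightarrow> ('a \<Rightarrow> 'b) \<Rightarrow> bool" where
  "iso_sep S T f \<longleftrightarrow> bij_betw f (seps S) (seps T) \<and> hom_sep S T f \<and>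
     hom_sep T S (inv_into (seps S) f)"

definition iso_tree_set :: "'a sepsys \<Rightarrow> 'b sepsys \<Rightarrow> ('a \<Rightarrow> 'b) \<Rightarrow> bool" where
  "iso_tree_set S T f \<longleftrightarrow> tree_set S \<and> tree_set T \<and> iso_sep S T f"

definition directed_poset :: "'p set \<Rightarrow> ('p \<Rightarrow> 'p \<Rightarrow> bool) \<Rightarrow> bool" where
  "directed_poset P R \<longleftrightarrow> poset_on P R \<and>
     (\<forall>p\<in>P. \<forall>q\<in>P. \<exists>t\<in>P. R p t \<and> R q t)"

text \<open>\<open>f q p\<close> is the bonding map from \<open>S q\<close> to \<open>S p\<close>. The systems \<open>S p\<close> are carried by
  subsets of a common type, which is no restriction: being finite, they even embed into \<open>nat\<close>.\<close>

definition finite_inverse_system ::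
  "'p set \<Rightarrow> ('p \<Rightarrow> 'p \<Rightarrow> bool) \<Rightarrow> ('p \<Rightarrow> 'b sepsys) \<Rightarrow> ('p \<Rightarrow> 'p \<Rightarrow> 'b \<Rightarrow> 'b) \<Rightarrow> bool" where
  "finite_inverse_system P R S f \<longleftrightarrow> directed_poset P R \<and>
     (\<forall>p\<in>P. separation_system (S p) \<and> finite (seps (S p))) \<and>
     (\<forall>p\<in>P. \<forall>q\<in>P. R p q \<longrightarrow> hom_sep (S q) (S p) (f q p)) \<and>
     (\<forall>p\<in>P. \<forall>s\<in>seps (S p). f p p s = s) \<and>
     (\<forall>p\<in>P. \<forall>q\<in>P. \<forall>t\<in>P. R p q \<longrightarrow> R q t \<longrightarrow>
        (\<forall>s\<in>seps (S t). f q p (f t q s) = f t p s))"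

text \<open>Families indexed by \<open>P\<close> are functions that are \<open>undefined\<close> outside \<open>P\<close>.\<close>

definition inverse_limit ::
  "'p set \<Rightarrow> ('p \<Rightarrow> 'p \<Rightarrow> bool) \<Rightarrow> ('p \<Rightarrow> 'b sepsys) \<Rightarrow> ('p \<Rightarrow> 'p \<Rightarrow> 'b \<Rightarrow> 'b) \<Rightarrow> ('p \<Rightarrow> 'b) sepsys" where
  "inverse_limit P R S f =
     \<lparr>seps = {x \<in> (\<Pi>\<^sub>E p\<in>P. seps (S p)). \<forall>p\<in>P. \<forall>q\<in>P. R p q \<longrightarrow> f q p (x q) = x p},
      sle = (\<lambda>x y. \<forall>p\<in>P. sle (S p) (x p) (y p)),
      sinv = (\<lambda>x. \<lambda>p\<in>P. sinv (S p) (x p))\<rparr>"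

text \<open>HOL cannot quantify over the types of the index set and of the finite systems inside a
  definition, so they are parameters. Left as type variables in an assumption of a theorem, they
  are universally quantified there, which makes the assumption existential in them, as intended.\<close>

definition profinite :: "'p itself \<Rightarrow> 'b itself \<Rightarrow> 'a sepsys \<Rightarrow> bool" where
  "profinite (_ :: 'p itself) (_ :: 'b itself) T \<longleftrightarrow>
     (\<exists>(P :: 'p set) R (S :: 'p \<Rightarrow> 'b sepsys) f g.
        finite_inverse_system P R S f \<and> iso_sep T (inverse_limit P R S f) g)"

definition bipartitions :: "'x set \<Rightarrow> ('x set \<times> 'x set) sepsys" where
  "bipartitions X =
     \<lparr>seps = {(A, B). A \<noteq> {} \<and> B \<noteq> {} \<and> A \<inter> B = {} \<and> A \<union> B = X},
      sle = (\<lambda>(A, B) (C, D). A \<subseteq> C),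
      sinv = (\<lambda>(A, B). (B, A))\<rparr>"

definition subsystem :: "'a sepsys \<Rightarrow> 'a set \<Rightarrow> 'a sepsys" where
  "subsystem S A = S\<lparr>seps := A\<rparr>"

definition greatest_orientations :: "'a sepsys \<Rightarrow> 'a set set" where
  "greatest_orientations S =
     {O'. orientation S O' \<and> consistent S O' \<and> (\<exists>m\<in>O'. \<forall>r\<in>O'. sle S r m)}"

definition greatest_orientations_at :: "'a sepsys \<Rightarrow> 'a \<Rightarrow> 'a set set" where
  "greatest_orientations_at S s = {O' \<in> greatest_orientations S. s \<in> O'}"

definition bipartition_map :: "'a sepsys \<Rightarrow> 'a \<Rightarrow> 'a set set \<times> 'a set set" where
  "bipartition_map S s = (greatest_orientations_at S (sinv S s), greatest_orientations_at S s)"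

lemma separation_system_bipartitions: "separation_system (bipartitions X)"
  unfolding separation_system_def poset_on_def bipartitions_def
  by (auto simp: reflp_on_def antisymp_on_def transp_on_def)

lemma separation_system_inverse_limit:
  assumes "finite_inverse_system P R S f"
  shows "separation_system (inverse_limit P R S f)"
proof -
  have sys: "separation_system (S p)" if "p \<in> P" for p
    using assms that by (auto simp: finite_inverse_system_def)
  have hom: "hom_sep (S q) (S p) (f q p)" if "p \<in> P" "q \<in> P" "R p q" for p q
    using assms that by (auto simp: finite_inverse_system_def)
  let ?L = "inverse_limit P R S f"
  have mem: "x p \<in> seps (S p)" if "x \<in> seps ?L" "p \<in> P" for x p
    using that by (auto simp: inverse_limit_def)
  have ext: "x = y" if "x \<in> seps ?L" "y \<in> seps ?L" "\<And>p. p \<in> P \<Longrightarrow> x p = y p" for x y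
    using that PiE_ext[of x P "\<lambda>p. seps (S p)" y] by (simp add: inverse_limit_def)
  have inv: "sinv ?L x \<in> seps ?L" if x: "x \<in> seps ?L" for x
  proof -
    have "sinv (S p) (x p) \<in> seps (S p)" if "p \<in> P" for p
      using sys[OF that] mem[OF x that] by (auto simp: separation_system_def)
    moreover have "f q p (sinv (S q) (x q)) = sinv (S p) (x p)" if "p \<in> P" "q \<in> P" "R p q" for p q
      using hom[OF that] mem[OF x that(2)] x that by (simp add: hom_sep_def inverse_limit_def)
    ultimately show ?thesis by (auto simp: inverse_limit_def)
  qed
  have sinv_apply: "sinv ?L x p = sinv (S p) (x p)" if "p \<in> P" for x p
    using that by (simp add: inverse_limit_def)
  have sle_iff: "sle ?L x y \<longleftrightarrow> (\<forall>p\<in>P. sle (S p) (x p) (y p))" for x y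
    by (simp add: inverse_limit_def)
  have "poset_on (seps ?L) (sle ?L)"
    unfolding poset_on_def
  proof (intro conjI)
    show "reflp_on (seps ?L) (sle ?L)"
      using sys mem unfolding reflp_on_def sle_iff separation_system_def poset_on_def by blast
    show "antisymp_on (seps ?L) (sle ?L)"
      using sys mem ext unfolding antisymp_on_def sle_iff separation_system_def poset_on_def by metis
    show "transp_on (seps ?L) (sle ?L)"
      using sys mem unfolding transp_on_def sle_iff separation_system_def poset_on_def by meson
  qed
  moreover have "sinv ?L (sinv ?L x) = x" if x: "x \<in> seps ?L" for x
  proof (rule ext[OF inv[OF inv[OF x]] x])
    show "sinv ?L (sinv ?L x) p = x p" if "p \<in> P" for p
      using sys[OF that] mem[OF x that] that by (simp add: sinv_apply separation_system_def)
  qed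
  moreover have "sle ?L (sinv ?L y) (sinv ?L x)"
    if "x \<in> seps ?L" "y \<in> seps ?L" "sle ?L x y" for x y
    using that sys mem by (simp add: sle_iff sinv_apply separation_system_def)
  ultimately show ?thesis
    using inv by (auto simp: separation_system_def)
qed

end

theory Submission
  imports Defs
begin

text \<open>
  In a regular tree set the consistent orientations with a greatest element include the
  down-closures of the maximal separations. By compactness every separation lies below a maximal
  one, so each \<open>\<phi>(s)\<close> is a bipartition; consistency makes \<open>\<phi>\<close> order-preserving. The point is that
  \<open>\<phi>\<close> also reflects the order, which by nestedness comes down to separating \<open>s < r\<close>: some maximal
  separation has to lie above both \<open>s\<close> and the inverse of \<open>r\<close>. By compactness again we may take
  \<open>r\<close> to cover \<open>s\<close>. Then \<open>s\<close> and \<open>r*\<close> are maximal in a common consistent orientation, the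
  orientation contains an \<open>x\<close> below neither of them because there is no splitting two-star, and any
  maximal separation above \<open>x*\<close> is as desired.
\<close>

section \<open>Separation systems and isomorphisms\<close>

context
  fixes S :: "'a sepsys"
  assumes sys: "separation_system S"
begin

lemma sle_refl: "x \<in> seps S \<Longrightarrow> sle S x x"
  using sys by (auto simp: separation_system_def poset_on_def reflp_on_def)

lemma sle_antisym:
  "x \<in> seps S \<Longrightarrow> y \<in> seps S \<Longrightarrow> sle S x y \<Longrightarrow> sle S y x \<Longrightarrow> x = y"
  using sys by (auto simp: separation_system_def poset_on_def antisymp_on_def)

lemma sle_trans:
  "x \<in> seps S \<Longrightarrow> y \<in> seps S \<Longrightarrow> z \<in> seps S \<Longrightarrow> sle S x y \<Longrightarrow> sle S y z \<Longrightarrow> sle S x z"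
  using sys unfolding separation_system_def poset_on_def transp_on_def by blast

lemma sinv_closed: "x \<in> seps S \<Longrightarrow> sinv S x \<in> seps S"
  using sys by (auto simp: separation_system_def)

lemma sinv_sinv: "x \<in> seps S \<Longrightarrow> sinv S (sinv S x) = x"
  using sys by (auto simp: separation_system_def)

lemma sinv_antimono:
  "x \<in> seps S \<Longrightarrow> y \<in> seps S \<Longrightarrow> sle S x y \<Longrightarrow> sle S (sinv S y) (sinv S x)"
  using sys by (auto simp: separation_system_def)

lemma sle_sinv_swap:
  "x \<in> seps S \<Longrightarrow> y \<in> seps S \<Longrightarrow> sle S x (sinv S y) \<Longrightarrow> sle S y (sinv S x)"
  using sinv_antimono[of x "sinv S y"] by (simp add: sinv_closed sinv_sinv)

lemma sinv_sle_swap: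
  "x \<in> seps S \<Longrightarrow> y \<in> seps S \<Longrightarrow> sle S (sinv S x) y \<Longrightarrow> sle S (sinv S y) x"
  using sinv_antimono[of "sinv S x" y] by (simp add: sinv_closed sinv_sinv)

text \<open>Of the four comparisons between orientations, \<open>r* \<le> s*\<close> becomes
  \<open>s \<le> r\<close> under the involution.\<close>

lemma nested_cases:
  assumes "nested S r s" "r \<in> seps S" "s \<in> seps S"
  obtains "sle S r s" | "sle S s r" | "sle S r (sinv S s)" | "sle S (sinv S r) s"
  using assms sinv_antimono[of "sinv S r" "sinv S s"] sinv_closed sinv_sinv
  unfolding nested_def unoriented_def by auto

end

lemma maximal_elementI:
  "m \<in> A \<Longrightarrow> (\<And>x. x \<in> A \<Longrightarrow> sle S m x \<Longrightarrow> x = m) \<Longrightarrow> m \<in> maximal_elements S A"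
  unfolding maximal_elements_def sless_def by blast

section \<open>Transport along an isomorphism of separation systems\<close>

context
  fixes S :: "'a sepsys" and T :: "'b sepsys" and g
  assumes iso: "iso_sep S T g"
begin

lemma iso_sep_closed: "x \<in> seps S \<Longrightarrow> g x \<in> seps T"
  using iso by (auto simp: iso_sep_def bij_betw_def)

lemma iso_sep_image: "g ` seps S = seps T"
  using iso by (simp add: iso_sep_def bij_betw_def)

lemma iso_sep_eq_iff: "x \<in> seps S \<Longrightarrow> y \<in> seps S \<Longrightarrow> g x = g y \<longleftrightarrow> x = y"
  using iso by (auto simp: iso_sep_def bij_betw_def inj_on_eq_iff)

lemma iso_sep_sinv: "x \<in> seps S \<Longrightarrow> g (sinv S x) = sinv T (g x)"
  using iso by (simp add: iso_sep_def hom_sep_def)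

lemma iso_sep_sle_iff:
  assumes "x \<in> seps S" "y \<in> seps S"
  shows "sle T (g x) (g y) \<longleftrightarrow> sle S x y"
proof -
  have "inv_into (seps S) g (g z) = z" if "z \<in> seps S" for z
    using iso that by (simp add: iso_sep_def bij_betw_def)
  with iso assms iso_sep_closed show ?thesis
    unfolding iso_sep_def hom_sep_def by metis
qed

text \<open>Nestedness, degeneracy and triviality are phrased through order, involution and
  equality, which an isomorphism preserves and reflects. This later makes the image of
  \<open>bipartition_map\<close> a tree set.\<close>

lemma iso_sep_tree_set:
  assumes "tree_set S" "separation_system T"
  shows "tree_set T"
proof -
  have sys: "separation_system S" using assms(1) by (simp add: tree_set_def)
  note closed = sinv_closed[OF sys]
  have "nested T (g r) (g s)" if "r \<in> seps S" "s \<in> seps S" for r s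
  proof -
    have "nested S r s" using assms(1) that by (simp add: tree_set_def)
    then show ?thesis
      using that closed unfolding nested_def unoriented_def
      by (auto simp flip: iso_sep_sinv simp: iso_sep_sle_iff)
  qed
  moreover have "\<not> degenerate T (g s)" if "s \<in> seps S" for s
    using assms(1) that closed unfolding tree_set_def degenerate_def
    by (auto simp flip: iso_sep_sinv simp: iso_sep_eq_iff)
  moreover have "\<not> trivial_sep T (g s)" if "s \<in> seps S" for s
    using assms(1) that closed
    unfolding tree_set_def trivial_sep_def sless_def iso_sep_image[symmetric]
    by (auto simp flip: iso_sep_sinv simp: iso_sep_eq_iff iso_sep_sle_iff)
  ultimately show ?thesis
    using assms(2) unfolding tree_set_def iso_sep_image[symmetric] by blast
qed

end

lemma iso_sepI:
  assumes "f ` seps S = seps T"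
    and "\<And>s. s \<in> seps S \<Longrightarrow> sinv S s \<in> seps S"
    and "\<And>s. s \<in> seps S \<Longrightarrow> f (sinv S s) = sinv T (f s)"
    and "\<And>r s. r \<in> seps S \<Longrightarrow> s \<in> seps S \<Longrightarrow> sle T (f r) (f s) \<longleftrightarrow> sle S r s"
    and "inj_on f (seps S)"
  shows "iso_sep S T f"
proof -
  have "hom_sep T S (inv_into (seps S) f)"
    using assms unfolding hom_sep_def assms(1)[symmetric]
    by (auto simp flip: assms(3))
  moreover have "hom_sep S T f"
    using assms unfolding hom_sep_def by auto
  ultimately show ?thesis
    using assms unfolding iso_sep_def bij_betw_def by auto
qed

lemma separation_system_subsystem:
  assumes "separation_system S" "A \<subseteq> seps S" "sinv S ` A \<subseteq> A"
  shows "separation_system (subsystem S A)"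
  using assms unfolding separation_system_def subsystem_def poset_on_def
  by (auto intro: reflp_on_subset antisymp_on_subset transp_on_subset simp: subset_iff)

section \<open>Compactness of profinite separation systems\<close>

definition maximal_sep :: "'a sepsys \<Rightarrow> 'a \<Rightarrow> bool" where
  "maximal_sep S m \<longleftrightarrow> m \<in> seps S \<and> (\<forall>y\<in>seps S. sle S m y \<longrightarrow> y = m)"

text \<open>The larger separation is the first argument: \<open>r\<close> is an upper cover of
  \<open>s\<close>.\<close>

definition covers :: "'a sepsys \<Rightarrow> 'a \<Rightarrow> 'a \<Rightarrow> bool" where
  "covers S r s \<longleftrightarrow> r \<in> seps S \<and> s \<in> seps S \<and> sless S s r \<and>
     (\<forall>t\<in>seps S. sle S s t \<and> sle S t r \<longrightarrow> t = s \<or> t = r)"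

context
  fixes P :: "'p set" and R and S :: "'p \<Rightarrow> 'b sepsys" and f
  assumes inverse_system: "finite_inverse_system P R S f"
begin

abbreviation "L \<equiv> inverse_limit P R S f"

lemma component_separation_system: "p \<in> P \<Longrightarrow> separation_system (S p)"
  using inverse_system by (simp add: finite_inverse_system_def)

lemma limit_separation_system: "separation_system L"
  by (rule separation_system_inverse_limit[OF inverse_system])

lemma limit_closed: "x \<in> seps L \<Longrightarrow> p \<in> P \<Longrightarrow> x p \<in> seps (S p)"
  by (auto simp: inverse_limit_def)

lemma sle_limit: "sle L x y \<longleftrightarrow> (\<forall>p\<in>P. sle (S p) (x p) (y p))"
  by (simp add: inverse_limit_def)

lemma sinv_limit: "p \<in> P \<Longrightarrow> sinv L x p = sinv (S p) (x p)"
  by (simp add: inverse_limit_def)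

text \<open>Components are finite, so the chain attains a greatest value in each coordinate, and
  these values are compatible. That every coordinate of \<open>u\<close> is attained in
  \<open>C\<close> lets \<open>u\<close> inherit coordinatewise conditions.\<close>

lemma chain_upper_bound:
  assumes C: "C \<subseteq> seps L" "C \<noteq> {}"
    and chain: "\<And>x y. x \<in> C \<Longrightarrow> y \<in> C \<Longrightarrow> sle L x y \<or> sle L y x"
  obtains u where "u \<in> seps L" "\<And>c. c \<in> C \<Longrightarrow> sle L c u" "\<And>p. p \<in> P \<Longrightarrow> \<exists>c\<in>C. c p = u p"
proof -
  have "\<exists>m\<in>C. \<forall>c\<in>C. sle (S p) (c p) (m p)" if p: "p \<in> P" for p
  proof -
    let ?A = "(\<lambda>c. c p) ` C"
    have sub: "?A \<subseteq> seps (S p)" using C limit_closed p by auto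
    have "finite ?A"
      using sub inverse_system p by (auto simp: finite_inverse_system_def intro: finite_subset)
    moreover have "transp_on ?A (sle (S p))"
      using sub component_separation_system[OF p] unfolding separation_system_def poset_on_def
      by (auto intro: transp_on_subset)
    moreover have "totalp_on ?A (sle (S p))"
      using chain p unfolding totalp_on_def sle_limit by blast
    ultimately obtain a where a: "a \<in> ?A" "\<forall>x\<in>?A. x \<noteq> a \<longrightarrow> sle (S p) x a"
      using C Finite_Set.bex_greatest_element[of ?A "sle (S p)"] by blast
    have "sle (S p) x a" if "x \<in> ?A" for x
      using that a sub sle_refl[OF component_separation_system[OF p], of a] by (cases "x = a") auto
    with a(1) show ?thesis by auto
  qed
  then obtain m where m: "\<And>p. p \<in> P \<Longrightarrow> m p \<in> C"
    and max: "\<And>p c. p \<in> P \<Longrightarrow> c \<in> C \<Longrightarrow> sle (S p) (c p) (m p p)"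
    by metis
  define u where "u = (\<lambda>p\<in>P. m p p)"
  \<comment> \<open>Mapping the comparison of \<open>m p\<close> with \<open>m q\<close> at
    \<open>q\<close> down to \<open>p\<close> gives \<open>m p p \<le> m q p\<close>; the choice of
    \<open>m p\<close> gives the converse.\<close>
  have compat: "f q p (m q q) = m p p" if pq: "p \<in> P" "q \<in> P" "R p q" for p q
  proof -
    have hom: "hom_sep (S q) (S p) (f q p)"
      using inverse_system pq by (simp add: finite_inverse_system_def)
    have f: "f q p (c q) = c p" if "c \<in> C" for c
      using C that pq by (auto simp: inverse_limit_def)
    have mem: "m p \<in> seps L" "m q \<in> seps L" using m C pq by auto
    have "sle (S p) (f q p (m p q)) (f q p (m q q))"
      using hom max[of q "m p"] m pq limit_closed mem by (simp add: hom_sep_def)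
    then have "sle (S p) (m p p) (m q p)" using f m pq by simp
    moreover have "sle (S p) (m q p) (m p p)" using max m pq by simp
    ultimately show ?thesis
      using sle_antisym[OF component_separation_system] limit_closed mem f m pq by metis
  qed
  have "m p p \<in> seps (S p)" if "p \<in> P" for p
    using limit_closed[OF subsetD[OF C(1) m] that] that by blast
  then have "u \<in> seps L"
    using compat by (simp add: inverse_limit_def u_def)
  moreover have "sle L c u" if "c \<in> C" for c
    using max that by (simp add: sle_limit u_def)
  moreover have "\<exists>c\<in>C. c p = u p" if "p \<in> P" for p
    using m that by (auto simp: u_def)
  ultimately show thesis using that by blast
qed

text \<open>Zorn's lemma: a bound from \<open>chain_upper_bound\<close> agrees in each coordinate
  with a member of the chain, so \<open>Q\<close> passes to it. The family \<open>x\<close> only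
  witnesses non-emptiness; a lower bound for \<open>m\<close> has to be encoded in
  \<open>Q\<close>.\<close>

lemma coordinatewise_maximal:
  assumes x: "x \<in> seps L" "\<And>p. p \<in> P \<Longrightarrow> Q p (x p)"
  obtains m where "m \<in> seps L" "\<And>p. p \<in> P \<Longrightarrow> Q p (m p)"
    "\<And>y. y \<in> seps L \<Longrightarrow> (\<And>p. p \<in> P \<Longrightarrow> Q p (y p)) \<Longrightarrow> sle L m y \<Longrightarrow> y = m"
proof -
  let ?A = "{y \<in> seps L. \<forall>p\<in>P. Q p (y p)}"
  have "partial_order_on ?A (relation_of (sle L) ?A)"
    using sle_refl[OF limit_separation_system] sle_trans[OF limit_separation_system] sle_antisym[OF limit_separation_system]
    by (intro partial_order_on_relation_ofI) blast+
  moreover have "\<exists>u\<in>?A. \<forall>c\<in>C. sle L c u" if C: "C \<in> Chains (relation_of (sle L) ?A)" for C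
  proof (cases "C = {}")
    case True
    then show ?thesis using x by auto
  next
    case False
    have "C \<subseteq> ?A" using C Chains_relation_of by blast
    moreover have "sle L a b \<or> sle L b a" if "a \<in> C" "b \<in> C" for a b
      using C that by (auto simp: Chains_def relation_of_def)
    ultimately obtain u where "u \<in> seps L" "\<And>c. c \<in> C \<Longrightarrow> sle L c u"
      "\<And>p. p \<in> P \<Longrightarrow> \<exists>c\<in>C. c p = u p"
      using chain_upper_bound[of C] False by blast
    with \<open>C \<subseteq> ?A\<close> show ?thesis by (smt (verit) mem_Collect_eq subsetD)
  qed
  ultimately obtain m where "m \<in> ?A" "\<forall>y\<in>?A. sle L m y \<longrightarrow> y = m"
    using predicate_Zorn[of ?A "sle L"] by blast
  then show thesis using that by blast
qed

text \<open>Dual to the maximal version, applied to \<open>Q p\<close> composed with the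
  involution.\<close>

lemma coordinatewise_minimal:
  assumes x: "x \<in> seps L" "\<And>p. p \<in> P \<Longrightarrow> Q p (x p)"
  obtains m where "m \<in> seps L" "\<And>p. p \<in> P \<Longrightarrow> Q p (m p)"
    "\<And>y. y \<in> seps L \<Longrightarrow> (\<And>p. p \<in> P \<Longrightarrow> Q p (y p)) \<Longrightarrow> sle L y m \<Longrightarrow> y = m"
proof -
  note [simp] = sinv_closed[OF limit_separation_system] sinv_sinv[OF limit_separation_system]
  have twice: "sinv (S p) (sinv (S p) (y p)) = y p" if "y \<in> seps L" "p \<in> P" for y p
    using that sinv_sinv[OF component_separation_system] limit_closed by blast
  obtain m where m: "m \<in> seps L" "\<And>p. p \<in> P \<Longrightarrow> Q p (sinv (S p) (m p))"
    and max: "\<And>y. y \<in> seps L \<Longrightarrow> (\<And>p. p \<in> P \<Longrightarrow> Q p (sinv (S p) (y p))) \<Longrightarrow> sle L m y \<Longrightarrow> y = m"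
    by (rule coordinatewise_maximal[of "sinv L x" "\<lambda>p z. Q p (sinv (S p) z)"])
      (use x twice in \<open>auto simp: sinv_limit\<close>)
  show thesis
  proof (rule that[of "sinv L m"])
    fix y assume y: "y \<in> seps L" "\<And>p. p \<in> P \<Longrightarrow> Q p (y p)" "sle L y (sinv L m)"
    then have "sinv L y = m"
      using max[of "sinv L y"] twice sle_sinv_swap[OF limit_separation_system] m by (simp add: sinv_limit)
    then show "y = sinv L m" using y by auto
  qed (use m in \<open>auto simp: sinv_limit\<close>)
qed

text \<open>Being above \<open>s\<close> is a coordinatewise condition, and a maximal family
  satisfying it is maximal outright, since whatever lies above it is again above
  \<open>s\<close>.\<close>

lemma inverse_limit_below_maximal:
  assumes "s \<in> seps L"
  shows "\<exists>m. maximal_sep L m \<and> sle L s m"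
proof -
  obtain m where m: "m \<in> seps L" "\<And>p. p \<in> P \<Longrightarrow> sle (S p) (s p) (m p)"
    and max: "\<And>y. y \<in> seps L \<Longrightarrow> (\<And>p. p \<in> P \<Longrightarrow> sle (S p) (s p) (y p)) \<Longrightarrow> sle L m y \<Longrightarrow> y = m"
    using assms sle_refl[OF limit_separation_system assms]
    by (auto simp: sle_limit intro: coordinatewise_maximal[of s "\<lambda>p. sle (S p) (s p)"])
  have "sle L s m" using m by (simp add: sle_limit)
  then have "y = m" if "y \<in> seps L" "sle L m y" for y
    using max[OF that(1) _ that(2)] sle_trans[OF limit_separation_system assms m(1) that(1)] that
    by (simp add: sle_limit)
  with m \<open>sle L s m\<close> show ?thesis by (auto simp: maximal_sep_def)
qed

text \<open>Pick a coordinate \<open>p\<close> that distinguishes \<open>s < r\<close>. A maximal \<open>s'\<close> in \<open>[s, r]\<close> with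
  \<open>s'\<^sub>p\<close> not above \<open>r\<^sub>p\<close> is covered by a minimal \<open>r'\<close> in \<open>[s', r]\<close> with \<open>r'\<^sub>p\<close> above \<open>r\<^sub>p\<close>.\<close>

lemma inverse_limit_cover:
  assumes s: "s \<in> seps L" and r: "r \<in> seps L" and sr: "sless L s r"
  shows "\<exists>s' r'. covers L r' s' \<and> sle L s s' \<and> sle L r' r"
proof -
  have "\<not> sle L r s" using sle_antisym[OF limit_separation_system] s r sr by (auto simp: sless_def)
  then obtain p where p: "p \<in> P" "\<not> sle (S p) (r p) (s p)" by (auto simp: sle_limit)
  let ?Q = "\<lambda>q z. sle (S q) (s q) z \<and> sle (S q) z (r q) \<and> (q = p \<longrightarrow> \<not> sle (S p) (r p) z)"
  obtain s' where s': "s' \<in> seps L" "\<And>q. q \<in> P \<Longrightarrow> ?Q q (s' q)"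
    and max: "\<And>y. y \<in> seps L \<Longrightarrow> (\<And>q. q \<in> P \<Longrightarrow> ?Q q (y q)) \<Longrightarrow> sle L s' y \<Longrightarrow> y = s'"
    by (rule coordinatewise_maximal[of s ?Q])
      (use s r sr sle_refl[OF limit_separation_system s] p in \<open>auto simp: sle_limit sless_def\<close>)
  have ss': "sle L s s'" and s'r: "sle L s' r" using s' by (auto simp: sle_limit)
  let ?Q' = "\<lambda>q z. sle (S q) (s' q) z \<and> sle (S q) z (r q) \<and> (q = p \<longrightarrow> sle (S p) (r p) z)"
  obtain r' where r': "r' \<in> seps L" "\<And>q. q \<in> P \<Longrightarrow> ?Q' q (r' q)"
    and min: "\<And>y. y \<in> seps L \<Longrightarrow> (\<And>q. q \<in> P \<Longrightarrow> ?Q' q (y q)) \<Longrightarrow> sle L y r' \<Longrightarrow> y = r'"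
    by (rule coordinatewise_minimal[of r ?Q'])
      (use r s'r sle_refl[OF limit_separation_system r] p in \<open>auto simp: sle_limit\<close>)
  have s'r': "sle L s' r'" and r'r: "sle L r' r" using r' by (auto simp: sle_limit)
  have "s' \<noteq> r'" using s'(2)[OF p(1)] r'(2)[OF p(1)] by auto
  moreover have "t = s' \<or> t = r'" if t: "t \<in> seps L" "sle L s' t" "sle L t r'" for t
  proof -
    have "sle L s t" "sle L t r"
      using sle_trans[OF limit_separation_system] s r s' r' t ss' r'r by blast+
    \<comment> \<open>If \<open>t p\<close> is above \<open>r p\<close>, minimality of
      \<open>r'\<close> applies; otherwise maximality of \<open>s'\<close> does.\<close>
    then show ?thesis
      using max[of t] min[of t] t by (cases "sle (S p) (r p) (t p)") (auto simp: sle_limit)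
  qed
  ultimately show ?thesis
    using s' r' s'r' ss' r'r unfolding covers_def sless_def by blast
qed

end

section \<open>Transfer from inverse limits to profinite systems\<close>

lemma profinite_below_maximal:
  assumes "profinite TYPE('p) TYPE('b) T" "s \<in> seps T"
  obtains m where "maximal_sep T m" "sle T s m"
proof -
  obtain P :: "'p set" and R and S :: "'p \<Rightarrow> 'b sepsys" and f g
    where fis: "finite_inverse_system P R S f" and iso: "iso_sep T (inverse_limit P R S f) g"
    using assms(1) unfolding profinite_def by blast
  obtain m where "m \<in> seps T" "maximal_sep (inverse_limit P R S f) (g m)"
    "sle (inverse_limit P R S f) (g s) (g m)"
    using inverse_limit_below_maximal[OF fis iso_sep_closed[OF iso assms(2)]]
    unfolding maximal_sep_def iso_sep_image[OF iso, symmetric] by blast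
  then have "maximal_sep T m" "sle T s m"
    using assms(2) iso_sep_sle_iff[OF iso] iso_sep_eq_iff[OF iso] iso_sep_closed[OF iso]
    unfolding maximal_sep_def by blast+
  then show thesis by (rule that)
qed

lemma profinite_cover:
  assumes "profinite TYPE('p) TYPE('b) T" "s \<in> seps T" "r \<in> seps T" "sless T s r"
  obtains s' r' where "covers T r' s'" "sle T s s'" "sle T r' r"
proof -
  obtain P :: "'p set" and R and S :: "'p \<Rightarrow> 'b sepsys" and f g
    where fis: "finite_inverse_system P R S f" and iso: "iso_sep T (inverse_limit P R S f) g"
    using assms(1) unfolding profinite_def by blast
  let ?L = "inverse_limit P R S f"
  note le = iso_sep_sle_iff[OF iso] and eq = iso_sep_eq_iff[OF iso]
    and closed = iso_sep_closed[OF iso]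
  have "sless ?L (g s) (g r)"
    using assms le eq by (simp add: sless_def)
  then obtain s' r' where *: "s' \<in> seps T" "r' \<in> seps T" "covers ?L (g r') (g s')"
    "sle ?L (g s) (g s')" "sle ?L (g r') (g r)"
    using inverse_limit_cover[OF fis closed[OF assms(2)] closed[OF assms(3)]]
    unfolding covers_def iso_sep_image[OF iso, symmetric] by blast
  have "t = s' \<or> t = r'" if "t \<in> seps T" "sle T s' t" "sle T t r'" for t
    using * that closed[OF that(1)] le eq unfolding covers_def by blast
  then have "covers T r' s'"
    using * le eq unfolding covers_def sless_def by blast
  then show thesis
    using * assms le by (auto intro: that)
qed

section \<open>Orientations of regular tree sets\<close>

context
  fixes S :: "'a sepsys"
  assumes tree: "tree_set S" and reg: "regular S"
begin

lemma tree_set_separation_system: "separation_system S"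
  using tree by (simp add: tree_set_def)

lemmas tree_set_sinv_simps [simp] = sinv_closed[OF tree_set_separation_system] sinv_sinv[OF tree_set_separation_system]

lemma not_small: "s \<in> seps S \<Longrightarrow> \<not> sle S s (sinv S s)"
  using reg by (simp add: regular_def small_def)

lemma not_co_small: "s \<in> seps S \<Longrightarrow> \<not> sle S (sinv S s) s"
  using not_small[of "sinv S s"] by simp

text \<open>Otherwise \<open>m* \<le> s \<le> m\<close>, so \<open>m*\<close> would be small,
  against regularity.\<close>

lemma not_below_both:
  assumes "s \<in> seps S" "m \<in> seps S" "sle S s m" "sle S (sinv S s) m"
  shows False
proof -
  have "sle S (sinv S m) s" using sinv_sle_swap[OF tree_set_separation_system] assms by simp
  then show False
    using sle_trans[OF tree_set_separation_system, of "sinv S m" s m] not_co_small assms by simp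
qed

lemma sinv_neq: "s \<in> seps S \<Longrightarrow> sinv S s \<noteq> s"
  using not_small sle_refl[OF tree_set_separation_system] by metis

lemma tree_cases:
  assumes "r \<in> seps S" "s \<in> seps S"
  obtains "sle S r s" | "sle S s r" | "sle S r (sinv S s)" | "sle S (sinv S r) s"
  using nested_cases[OF tree_set_separation_system, of r s] tree assms by (auto simp: tree_set_def)

lemma orientationI:
  assumes "A \<subseteq> seps S" "\<And>s. s \<in> seps S \<Longrightarrow> s \<in> A \<or> sinv S s \<in> A"
    and "\<And>s. s \<in> A \<Longrightarrow> sinv S s \<notin> A"
  shows "orientation S A"
  using assms unfolding orientation_def unoriented_def by (metis insertE insertI1 insertI2 singletonD)

lemma orientation_sinv_iff:
  assumes "orientation S A" "s \<in> seps S"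
  shows "sinv S s \<in> A \<longleftrightarrow> s \<notin> A"
  using assms sinv_neq[of s] unfolding orientation_def unoriented_def by blast

text \<open>If \<open>r*\<close> were in \<open>A\<close> instead, \<open>r*\<close> and
  \<open>s\<close> would violate consistency, unless \<open>s = r*\<close>; but then
  \<open>r \<le> r*\<close> would be small.\<close>

lemma consistent_orientation_down_closed:
  assumes A: "orientation S A" "consistent S A"
    and s: "s \<in> A" and r: "r \<in> seps S" "sle S r s"
  shows "r \<in> A"
proof (rule ccontr)
  assume "r \<notin> A"
  then have r': "sinv S r \<in> A" using orientation_sinv_iff A r by blast
  have "s \<in> seps S" using A s by (auto simp: orientation_def)
  have "s \<noteq> r" using s \<open>r \<notin> A\<close> by auto
  have "unoriented S (sinv S r) = unoriented S s"
    using A r' s r unfolding consistent_def by force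
  then have "s = sinv S r" using \<open>s \<noteq> r\<close> r unfolding unoriented_def by auto
  with r not_small show False by blast
qed

text \<open>By nestedness with \<open>m\<close>, every separation has an orientation below
  \<open>m\<close>, the cases \<open>m \<le> s\<close> and \<open>m \<le> s*\<close> collapsing to
  equality. Regularity excludes having both.\<close>

lemma greatest_orientation_of_maximal:
  assumes "maximal_sep S m"
  shows "{r \<in> seps S. sle S r m} \<in> greatest_orientations S" (is "?A \<in> _")
proof -
  have m: "m \<in> seps S" and max: "\<And>y. y \<in> seps S \<Longrightarrow> sle S m y \<Longrightarrow> y = m"
    using assms by (auto simp: maximal_sep_def)
  have "s \<in> ?A \<or> sinv S s \<in> ?A" if "s \<in> seps S" for s
  proof (rule tree_cases[OF that m])
    assume "sle S m s"
    then show ?thesis using max[OF that] sle_refl[OF tree_set_separation_system m] m by simp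
  next
    assume "sle S s (sinv S m)"
    then have "sle S m (sinv S s)" using sle_sinv_swap[OF tree_set_separation_system] that m by blast
    then show ?thesis using max[of "sinv S s"] sle_refl[OF tree_set_separation_system m] that m by simp
  qed (use that in auto)
  moreover have neg: "sinv S s \<notin> ?A" if "s \<in> ?A" for s
    using not_below_both m that by blast
  ultimately have "orientation S ?A" by (intro orientationI) auto
  moreover have "consistent S ?A"
    unfolding consistent_def
    using neg m sle_trans[OF tree_set_separation_system] by (smt (verit) mem_Collect_eq tree_set_sinv_simps(1))
  ultimately show ?thesis
    using m sle_refl[OF tree_set_separation_system] unfolding greatest_orientations_def by blast
qed

text \<open>The orientation used here points towards the node of the tree between the edges \<open>s\<close> and \<open>r\<close>.\<close>

lemma covers_third_branch:
  assumes cov: "covers S r s" and no2: "\<nexists>\<sigma>. splitting_two_star S \<sigma>"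
  obtains x where "x \<in> seps S" "sle S s x" "sle S (sinv S r) x"
proof -
  let ?r = "sinv S r"
  \<comment> \<open>The tail of \<open>r\<close> is approached from its own side by separations
    strictly below \<open>r\<close>, and from across \<open>r\<close> by those below
    \<open>r*\<close>.\<close>
  let ?A = "{t \<in> seps S. sless S t r \<or> sle S t ?r}"
  have r: "r \<in> seps S" and s: "s \<in> seps S" and sr: "sle S s r" "s \<noteq> r"
    and gap: "\<And>t. t \<in> seps S \<Longrightarrow> sle S s t \<Longrightarrow> sle S t r \<Longrightarrow> t = s \<or> t = r"
    using cov by (auto simp: covers_def sless_def)
  note tr = sle_trans[OF tree_set_separation_system] and rf = sle_refl[OF tree_set_separation_system]
  \<comment> \<open>The two halves of \<open>?A\<close> are disjoint, because \<open>r\<close> would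
    witness that a common element is trivial.\<close>
  have nontriv: "\<not> (sless S t r \<and> sle S t ?r)" if "t \<in> seps S" for t
  proof
    assume *: "sless S t r \<and> sle S t ?r"
    then have "t \<noteq> ?r" using r not_co_small by (auto simp: sless_def)
    with * have "trivial_sep S t" using r unfolding trivial_sep_def sless_def by auto
    with that tree show False by (auto simp: tree_set_def)
  qed
  have total: "t \<in> ?A \<or> sinv S t \<in> ?A" if t: "t \<in> seps S" for t
  proof (cases "t = r \<or> t = ?r")
    case True
    then show ?thesis using r rf by auto
  next
    case False
    then have ne: "sinv S t \<noteq> r" using t by auto
    show ?thesis
      by (rule tree_cases[OF t r])
        (use False ne t r sinv_antimono[OF tree_set_separation_system, of r t] in \<open>auto simp: sless_def\<close>)
  qed
  \<comment> \<open>Within one half, \<open>t\<close> and \<open>t*\<close> would have a common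
    upper bound; across the halves, \<open>r\<close> would lie below something strictly below
    it.\<close>
  have one: "sinv S t \<notin> ?A" if tA: "t \<in> ?A" for t
  proof
    assume t': "sinv S t \<in> ?A"
    have t: "t \<in> seps S" using tA by simp
    consider "sless S t r" "sless S (sinv S t) r" | "sless S t r" "sle S (sinv S t) ?r"
      | "sle S t ?r" "sless S (sinv S t) r" | "sle S t ?r" "sle S (sinv S t) ?r"
      using tA t' by blast
    then show False
    proof cases
      case 1 then show False using not_below_both t r by (auto simp: sless_def)
    next
      case 2
      then have "sle S r t" using sinv_antimono[OF tree_set_separation_system, of "sinv S t" ?r] t r by simp
      then show False using 2 sle_antisym[OF tree_set_separation_system, of t r] t r by (auto simp: sless_def)
    next
      case 3
      then have "sle S r (sinv S t)" using sle_sinv_swap[OF tree_set_separation_system] t r by blast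
      then show False using 3 sle_antisym[OF tree_set_separation_system, of r "sinv S t"] t r by (auto simp: sless_def)
    next
      case 4 then show False using not_below_both[of t ?r] t r by simp
    qed
  qed
  have down: "q \<in> ?A" if "t \<in> ?A" "q \<in> seps S" "sle S q t" for q t
  proof (cases "sless S t r")
    case True
    then have "sle S q r" using tr[of q t r] that r by (simp add: sless_def)
    moreover have "q \<noteq> r" using True that r sle_antisym[OF tree_set_separation_system, of t r] by (auto simp: sless_def)
    ultimately show ?thesis using that by (simp add: sless_def)
  next
    case False
    then show ?thesis using tr[of q t ?r] that r by auto
  qed
  have ori: "orientation S ?A" using total one by (intro orientationI) auto
  have con: "consistent S ?A"
    unfolding consistent_def using down one by (smt (verit) mem_Collect_eq tree_set_sinv_simps(1))
  have sA: "s \<in> ?A" using s sr by (simp add: sless_def)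
  have rA: "?r \<in> ?A" using r rf by simp
  \<comment> \<open>In the first half this is the covering property; in the second, \<open>s\<close>
    would lie in both halves.\<close>
  have s_max: "t = s" if "t \<in> ?A" "sle S s t" for t
  proof (cases "sless S t r")
    case True
    then show ?thesis using gap[of t] that by (auto simp: sless_def)
  next
    case False
    then have "sle S s ?r" using tr[of s t ?r] that s r by auto
    then show ?thesis using nontriv[OF s] s sr by (simp add: sless_def)
  qed
  have r_max: "t = ?r" if "t \<in> ?A" "sle S ?r t" for t
  proof (cases "sless S t r")
    case True
    then have "sle S ?r r" using tr[of ?r t r] that r by (auto simp: sless_def)
    then show ?thesis using r not_co_small by blast
  next
    case False
    then show ?thesis using sle_antisym[OF tree_set_separation_system, of t ?r] that r by auto
  qed
  have ne: "s \<noteq> ?r" using sr r not_co_small by auto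
  \<comment> \<open>Otherwise \<open>s\<close> and \<open>r*\<close> are the only maximal elements
    of \<open>?A\<close> and bound all of it, so they form a splitting two-star.\<close>
  have "\<exists>x\<in>?A. \<not> sle S x s \<and> \<not> sle S x ?r"
  proof (rule ccontr)
    assume "\<not> ?thesis"
    then have below: "\<And>x. x \<in> ?A \<Longrightarrow> sle S x s \<or> sle S x ?r" by blast
    have "maximal_elements S ?A = {s, ?r}"
    proof
      show "maximal_elements S ?A \<subseteq> {s, ?r}"
        using below sA rA unfolding maximal_elements_def sless_def by blast
      show "{s, ?r} \<subseteq> maximal_elements S ?A"
        using maximal_elementI[OF sA s_max] maximal_elementI[OF rA r_max] by simp
    qed
    moreover have "star S {s, ?r}"
      using s r sr sinv_antimono[OF tree_set_separation_system, of s r] by (auto simp: star_def)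
    moreover have "\<forall>x\<in>?A. \<exists>y\<in>{s, ?r}. sle S x y" using below by simp
    ultimately have "splitting_star S {s, ?r}"
      using ori con unfolding splitting_star_def by (intro conjI exI[of _ ?A]) simp_all
    then show False using no2 ne by (auto simp: splitting_two_star_def)
  qed
  then obtain x where x: "x \<in> ?A" "\<not> sle S x s" "\<not> sle S x ?r" by blast
  \<comment> \<open>Nestedness leaves only \<open>y \<le> x*\<close>: the case
    \<open>y \<le> x\<close> contradicts maximality of \<open>y\<close>, and
    \<open>x* \<le> y\<close> would put \<open>x*\<close> into \<open>?A\<close> along with
    \<open>x\<close>.\<close>
  have opposite: "sle S y (sinv S x)" if "y \<in> ?A" "\<not> sle S x y" "\<And>t. t \<in> ?A \<Longrightarrow> sle S y t \<Longrightarrow> t = y" for y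
  proof -
    have xy: "x \<in> seps S" "y \<in> seps S" using x that by auto
    from xy show ?thesis
    proof (rule tree_cases)
      assume "sle S x y"
      with that(2) show ?thesis by simp
    next
      assume "sle S y x"
      then have "x = y" by (rule that(3)[OF x(1)])
      with that(2) rf[OF xy(2)] show ?thesis by simp
    next
      assume "sle S x (sinv S y)"
      then show ?thesis by (rule sle_sinv_swap[OF tree_set_separation_system xy])
    next
      assume "sle S (sinv S x) y"
      then have "sinv S x \<in> ?A" using xy by (intro down[OF that(1)]) simp_all
      with one[OF x(1)] show ?thesis by contradiction
    qed
  qed
  show thesis
  proof (rule that)
    show "sinv S x \<in> seps S" using x by simp
    show "sle S s (sinv S x)" by (rule opposite[OF sA x(2) s_max])
    show "sle S ?r (sinv S x)" by (rule opposite[OF rA x(3) r_max])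
  qed
qed

end

section \<open>The isomorphism onto the image in the bipartitions\<close>

theorem theorem4p4:
  fixes \<tau> :: "'a sepsys"
  assumes "tree_set \<tau>"
    and "regular \<tau>"
    and "profinite TYPE('p) TYPE('b) \<tau>"
    and "\<nexists>\<sigma>. splitting_two_star \<tau> \<sigma>"
  shows "bipartition_map \<tau> ` seps \<tau> \<subseteq> seps (bipartitions (greatest_orientations \<tau>)) \<and>
    iso_tree_set \<tau>
      (subsystem (bipartitions (greatest_orientations \<tau>)) (bipartition_map \<tau> ` seps \<tau>))
      (bipartition_map \<tau>)"
proof -
  note [simp] = tree_set_sinv_simps[OF assms(1,2)]
  note sys = tree_set_separation_system[OF assms(1,2)]
  let ?X = "greatest_orientations \<tau>" and ?at = "greatest_orientations_at \<tau>"
  let ?B = "subsystem (bipartitions ?X) (bipartition_map \<tau> ` seps \<tau>)"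
  have sinv_iff: "sinv \<tau> s \<in> A \<longleftrightarrow> s \<notin> A" if "A \<in> ?X" "s \<in> seps \<tau>" for A s
    using orientation_sinv_iff[OF assms(1,2)] that by (auto simp: greatest_orientations_def)
  have down: "r \<in> A" if "A \<in> ?X" "s \<in> A" "r \<in> seps \<tau>" "sle \<tau> r s" for A r s
    using consistent_orientation_down_closed[OF assms(1,2)] that
    by (auto simp: greatest_orientations_def)
  \<comment> \<open>The down-closure of a maximal separation above \<open>x\<close> serves as
    \<open>A\<close>.\<close>
  have ex: "\<exists>A\<in>?X. \<forall>s\<in>seps \<tau>. sle \<tau> s x \<longrightarrow> s \<in> A" if x: "x \<in> seps \<tau>" for x
  proof -
    obtain m where m: "maximal_sep \<tau> m" "sle \<tau> x m"
      using profinite_below_maximal[OF assms(3) x] by blast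
    then show ?thesis
      using greatest_orientation_of_maximal[OF assms(1,2) m(1)] sle_trans[OF sys _ x] m
      by (intro bexI[of _ "{r \<in> seps \<tau>. sle \<tau> r m}"]) (auto simp: maximal_sep_def)
  qed
  have nonempty: "?at s \<noteq> {}" if "s \<in> seps \<tau>" for s
    using ex[OF that] sle_refl[OF sys] that by (auto simp: greatest_orientations_at_def)
  have disj: "?at (sinv \<tau> s) = ?X - ?at s" if "s \<in> seps \<tau>" for s
    using sinv_iff that by (auto simp: greatest_orientations_at_def)
  have at_sub: "?at s \<subseteq> ?X" for s by (auto simp: greatest_orientations_at_def)
  have mono: "?at s \<subseteq> ?at r" if "r \<in> seps \<tau>" "sle \<tau> r s" for r s
    using down that by (auto simp: greatest_orientations_at_def)
  have img: "bipartition_map \<tau> ` seps \<tau> \<subseteq> seps (bipartitions ?X)"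
  proof
    fix z assume "z \<in> bipartition_map \<tau> ` seps \<tau>"
    then obtain s where s: "s \<in> seps \<tau>" and z: "z = bipartition_map \<tau> s" by blast
    have "?at (sinv \<tau> s) \<noteq> {}" using nonempty s by simp
    moreover have "?at (sinv \<tau> s) \<inter> ?at s = {}" "?at (sinv \<tau> s) \<union> ?at s = ?X"
      using disj[OF s] at_sub[of s] by blast+
    ultimately show "z \<in> seps (bipartitions ?X)"
      using nonempty[OF s] by (simp add: z bipartitions_def bipartition_map_def)
  qed
  have sinv_B: "sinv (bipartitions ?X) (bipartition_map \<tau> s) = bipartition_map \<tau> (sinv \<tau> s)"
    if "s \<in> seps \<tau>" for s
    using that by (simp add: bipartition_map_def bipartitions_def)
  \<comment> \<open>The hypothesis compares first components of the bipartitions, hence the inverses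
    in it.\<close>
  have reflect: "sle \<tau> r s"
    if r: "r \<in> seps \<tau>" and s: "s \<in> seps \<tau>" and sub: "?at (sinv \<tau> r) \<subseteq> ?at (sinv \<tau> s)" for r s
  proof (rule ccontr)
    assume nle: "\<not> sle \<tau> r s"
    have sub': "?at s \<subseteq> ?at r" using sub disj r s at_sub by blast
    from r s show False
    proof (rule tree_cases[OF assms(1,2)])
      assume "sle \<tau> r s"
      with nle show False by blast
    next
      assume "sle \<tau> s r"
      with nle sle_refl[OF sys r] have "sless \<tau> s r" by (auto simp: sless_def)
      \<comment> \<open>The third branch at a cover inside \<open>[s, r]\<close> yields
        \<open>x\<close> above \<open>s\<close> and \<open>r*\<close>. An orientation in
        \<open>?X\<close> containing everything below \<open>x\<close> then contains
        \<open>s\<close> but not \<open>r\<close>, against \<open>sub'\<close>.\<close>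
      then obtain s' r' where c: "covers \<tau> r' s'" and le: "sle \<tau> s s'" "sle \<tau> r' r"
        using profinite_cover[OF assms(3) s r] by blast
      have s': "s' \<in> seps \<tau>" and r': "r' \<in> seps \<tau>" using c by (auto simp: covers_def)
      obtain x where x: "x \<in> seps \<tau>" "sle \<tau> s' x" "sle \<tau> (sinv \<tau> r') x"
        using covers_third_branch[OF assms(1,2) c assms(4)] by blast
      have "sle \<tau> s x" using sle_trans[OF sys s s' x(1)] le x by blast
      moreover have "sle \<tau> (sinv \<tau> r) x"
        using sle_trans[OF sys _ _ x(1), of "sinv \<tau> r" "sinv \<tau> r'"] sinv_antimono[OF sys r' r] le x r r'
        by simp
      ultimately obtain A where "A \<in> ?X" "s \<in> A" "sinv \<tau> r \<in> A"
        using ex[OF x(1)] s r by force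
      then show False
        using sub' sinv_iff r by (auto simp: greatest_orientations_at_def)
    next
      \<comment> \<open>Here the non-empty set \<open>?at (sinv \<tau> r)\<close> would lie inside
        its own complement.\<close>
      assume "sle \<tau> r (sinv \<tau> s)"
      then have "?at (sinv \<tau> s) \<subseteq> ?at r" using mono r by blast
      with sub have "?at (sinv \<tau> r) \<subseteq> ?at r" by blast
      with disj[OF r] nonempty[of "sinv \<tau> r"] r show False by auto
    next
      \<comment> \<open>Here the non-empty set \<open>?at s\<close> would lie in two complementary
        sets.\<close>
      assume "sle \<tau> (sinv \<tau> r) s"
      then have "?at s \<subseteq> ?at (sinv \<tau> r)" using mono r by simp
      with sub' disj[OF r] nonempty[OF s] show False by blast
    qed
  qed
  have le_iff: "sle ?B (bipartition_map \<tau> r) (bipartition_map \<tau> s) \<longleftrightarrow> sle \<tau> r s"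
    if "r \<in> seps \<tau>" "s \<in> seps \<tau>" for r s
    using reflect that mono[of "sinv \<tau> s" "sinv \<tau> r"] sinv_antimono[OF sys that]
    by (auto simp: bipartition_map_def bipartitions_def subsystem_def)
  have "inj_on (bipartition_map \<tau>) (seps \<tau>)"
  proof (rule inj_onI)
    fix r s
    assume *: "r \<in> seps \<tau>" "s \<in> seps \<tau>" "bipartition_map \<tau> r = bipartition_map \<tau> s"
    then have "sle \<tau> r s" "sle \<tau> s r" using reflect by (simp_all add: bipartition_map_def)
    with * show "r = s" by (intro sle_antisym[OF sys])
  qed
  then have iso: "iso_sep \<tau> ?B (bipartition_map \<tau>)"
    using sinv_B le_iff by (intro iso_sepI) (simp_all add: subsystem_def)
  have "sinv (bipartitions ?X) ` bipartition_map \<tau> ` seps \<tau> \<subseteq> bipartition_map \<tau> ` seps \<tau>"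
    using sinv_B by auto
  then have "separation_system ?B"
    by (intro separation_system_subsystem separation_system_bipartitions img)
  then show ?thesis
    using img iso iso_sep_tree_set[OF iso assms(1)] assms(1) by (simp add: iso_tree_set_def)
qed

end
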